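(* Let $\alpha>0$ and $\beta>h(\alpha)$. Then the inequality $|E_{\alpha,\beta}(z)|\ge E_{\alpha,\beta}(\Re z)$ does not hold globally, i.e. there exists $z\in\mathbb{C}$ with $|E_{\alpha,\beta}(z)|<E_{\alpha,\beta}(\Re z)$.
   Context: For $\alpha>0$ and $\beta\in\mathbb{R}$, the two-parameter Mittag-Leffler function is the entire function $E_{\alpha,\beta}(z)=\sum_{k=0}^{\infty}\frac{z^k}{\Gamma(\alpha k+\beta)}$, $z\in\mathbb{C}$. $\Re z$ denotes the real part of $z$. For each $x>0$, $h(x)$ denotes the unique solution $y=h(x)>0$ of the equation $2\,\Gamma(x+y)^2=\Gamma(y)\,\Gamma(2x+y)$ (existence and uniqueness hold for every $x>0$). *)

theory Defs
  imports "HOL-Analysis.Analysis"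
begin

text \<open>
  The definition is polymorphic so that it can be used at type \<^typ>\<open>complex\<close> (the entire
  function) and at type \<^typ>\<open>real\<close> (its real-valued restriction to the real line). At the
  poles of \<^const>\<open>Gamma\<close> the library sets \<^const>\<open>Gamma\<close> to 0, and division by 0 gives 0, which
  agrees with the usual convention that the reciprocal of \<^const>\<open>Gamma\<close> vanishes there.
\<close>

definition mittag_leffler ::
    "real \<Rightarrow> real \<Rightarrow> 'a::{real_normed_field,banach} \<Rightarrow> 'a" where
  "mittag_leffler \<alpha> \<beta> z = (\<Sum>k. z ^ k / of_real (Gamma (\<alpha> * real k + \<beta>)))"

text \<open>
  Meaningful for \<open>x > 0\<close> only: there the quotient \<open>Gamma y * Gamma (2 * x + y) / Gamma (x + y)\<^sup>2\<close>
  decreases strictly in \<open>y > 0\<close> from infinity to 1, so that exactly one such \<open>y\<close> exists.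
\<close>

definition h :: "real \<Rightarrow> real" where
  "h x = (THE y. y > 0 \<and> 2 * Gamma (x + y) ^ 2 = Gamma y * Gamma (2 * x + y))"

end

theory Submission
  imports Defs
begin

text \<open>
  Write \<open>a\<^sub>k = 1 / Gamma (\<alpha> * k + \<beta>)\<close>. On the imaginary axis
  \<open>\<bar>E(i y)\<bar>\<^sup>2 = a\<^sub>0\<^sup>2 - (2 a\<^sub>0 a\<^sub>2 - a\<^sub>1\<^sup>2) y\<^sup>2 + O(y\<^sup>3)\<close>, while \<open>E(Re (i y)) = E(0) = a\<^sub>0\<close>.
  So any small \<open>y > 0\<close> is a witness as soon as \<open>a\<^sub>1\<^sup>2 < 2 a\<^sub>0 a\<^sub>2\<close>, that is, as soon as
  \<open>Gamma \<beta> * Gamma (2 * \<alpha> + \<beta>) < 2 * Gamma (\<alpha> + \<beta>)\<^sup>2\<close>. The latter is equivalent to \<open>\<beta> > h \<alpha>\<close>,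
  because the second difference of \<open>ln Gamma\<close> with step \<open>\<alpha>\<close> decreases strictly from infinity
  to 0: the derivative \<open>Digamma\<close> of \<open>ln Gamma\<close> is strictly concave.
\<close>

section \<open>Second difference of \<open>ln_Gamma\<close> and its strict monotonicity\<close>

definition ln_Gamma_diff2 :: "real \<Rightarrow> real \<Rightarrow> real" where
  "ln_Gamma_diff2 x y = ln_Gamma y + ln_Gamma (2 * x + y) - 2 * ln_Gamma (x + y)"

lemma ln_Gamma_diff2_altdef:
  assumes "x > 0" "y > 0"
  shows "ln_Gamma_diff2 x y = ln (Gamma y * Gamma (2 * x + y) / Gamma (x + y) ^ 2)"
proof -
  have "ln (p * q / r ^ 2) = ln p + ln q - 2 * ln r" if "p > 0" "q > 0" "r > 0" for p q r :: real
    using that by (simp add: ln_div ln_mult ln_realpow)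
  then show ?thesis
    using assms by (simp add: ln_Gamma_diff2_def ln_Gamma_real_pos)
qed

lemma ln_Gamma_diff2_eq_ln2_iff:
  assumes "x > 0" "y > 0"
  shows "ln_Gamma_diff2 x y = ln 2 \<longleftrightarrow> 2 * Gamma (x + y) ^ 2 = Gamma y * Gamma (2 * x + y)"
proof -
  have *: "ln (p * q / r ^ 2) = ln 2 \<longleftrightarrow> 2 * r ^ 2 = p * q"
    if "p > 0" "q > 0" "r > 0" for p q r :: real
    using that by (subst ln_inj_iff) (auto simp: field_simps)
  show ?thesis
    unfolding ln_Gamma_diff2_altdef[OF assms] using assms by (intro * Gamma_real_pos) auto
qed

lemma ln_Gamma_diff2_less_ln2_iff:
  assumes "x > 0" "y > 0"
  shows "ln_Gamma_diff2 x y < ln 2 \<longleftrightarrow> Gamma y * Gamma (2 * x + y) < 2 * Gamma (x + y) ^ 2"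
proof -
  have *: "ln (p * q / r ^ 2) < ln 2 \<longleftrightarrow> p * q < 2 * r ^ 2"
    if "p > 0" "q > 0" "r > 0" for p q r :: real
    using that by (subst ln_less_cancel_iff) (auto simp: field_simps)
  show ?thesis
    unfolding ln_Gamma_diff2_altdef[OF assms] using assms by (intro * Gamma_real_pos) auto
qed

text \<open>The mean value theorem on the two halves of \<open>[y, 2 * x + y]\<close> turns both
  increments of \<open>Digamma\<close> into \<open>x\<close> times values of
  \<open>Polygamma 1\<close>, which is strictly decreasing.\<close>

lemma Digamma_strict_midpoint_concave:
  fixes x y :: real
  assumes "x > 0" "y > 0"
  shows "Digamma y + Digamma (2 * x + y) < 2 * Digamma (x + y)"
proof -
  have der: "(Digamma has_field_derivative Polygamma 1 t) (at t)" if "t > 0" for t :: real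
    using that has_field_derivative_Polygamma[of t 0 UNIV] by (fastforce elim!: nonpos_Ints_cases)
  obtain s where s: "y < s" "s < x + y" "Digamma (x + y) - Digamma y = x * Polygamma 1 s"
    using MVT2[of y "x + y" Digamma "Polygamma 1"] der assms by auto
  obtain t where t: "x + y < t" "t < 2 * x + y"
    "Digamma (2 * x + y) - Digamma (x + y) = x * Polygamma 1 t"
    using MVT2[of "x + y" "2 * x + y" Digamma "Polygamma 1"] der assms by auto
  have "Polygamma 1 t < Polygamma 1 s"
    using s t assms by (intro Polygamma_real_strict_antimono) auto
  with s t assms have "x * Polygamma 1 t < x * Polygamma 1 s" by simp
  with s t show ?thesis by linarith
qed

lemma has_field_derivative_ln_Gamma_diff2:
  assumes "x > 0" "y > 0"
  shows "(ln_Gamma_diff2 x has_field_derivative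
           (Digamma y + Digamma (2 * x + y) - 2 * Digamma (x + y))) (at y)"
  unfolding ln_Gamma_diff2_def[abs_def] using assms by (auto intro!: derivative_eq_intros)

lemma ln_Gamma_diff2_strict_antimono:
  assumes "x > 0" "0 < y" "y < z"
  shows "ln_Gamma_diff2 x z < ln_Gamma_diff2 x y"
proof (rule DERIV_neg_imp_decreasing[OF assms(3)])
  fix t assume "y \<le> t" "t \<le> z"
  then have "t > 0" using assms by simp
  then show "\<exists>d. (ln_Gamma_diff2 x has_real_derivative d) (at t) \<and> d < 0"
    using has_field_derivative_ln_Gamma_diff2[OF assms(1), of t]
      Digamma_strict_midpoint_concave[OF assms(1), of t] by (intro exI conjI) auto
qed

section \<open>Behaviour of the second difference near 0 and for large arguments\<close>

lemma ln_Gamma_diff2_at_right_0: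
  assumes "x > 0"
  shows "filterlim (ln_Gamma_diff2 x) at_top (at_right 0)"
proof -
  \<comment> \<open>By \<open>Gamma (y + 1) = y * Gamma y\<close>, passing from
    \<open>ln_Gamma y\<close> to \<open>ln_Gamma (y + 1)\<close> splits off the singular term
    \<open>- ln y\<close>; what remains is continuous at 0.\<close>
  define g where "g y = ln_Gamma (y + 1) + ln_Gamma (2 * x + y) - 2 * ln_Gamma (x + y)" for y
  have "isCont g 0"
    unfolding g_def[abs_def] using assms
    by (intro DERIV_isCont) (auto intro!: derivative_eq_intros)
  then have "(g \<longlongrightarrow> g 0) (at_right 0)"
    unfolding isCont_def by (rule tendsto_within_subset) auto
  moreover have "filterlim (\<lambda>y::real. - ln y) at_top (at_right 0)"
    using ln_at_0 by (simp add: filterlim_uminus_at_bot)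
  ultimately have "filterlim (\<lambda>y. g y + - ln y) at_top (at_right 0)"
    by (rule filterlim_tendsto_add_at_top)
  moreover have "g y + - ln y = ln_Gamma_diff2 x y" if "y > 0" for y
  proof -
    have "Gamma (y + 1) = y * Gamma y"
      using that by (intro Gamma_plus1) (auto elim!: nonpos_Ints_cases)
    moreover have "ln (y * Gamma y) = ln y + ln (Gamma y)"
      using that Gamma_real_pos[OF that] by (intro ln_mult_pos)
    ultimately show ?thesis
      using that by (simp add: g_def ln_Gamma_diff2_def ln_Gamma_real_pos)
  qed
  ultimately show ?thesis
    by (subst (asm) filterlim_cong[OF refl refl])
       (auto simp: eventually_at_right_less intro!: eventually_mono[OF eventually_at_right_less])
qed

text \<open>Each unit step of the recurrence adds the reciprocal of the current argument, which is
  at most \<open>1 / y\<close>.\<close>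

lemma Digamma_add_of_nat_le:
  fixes y :: real
  assumes "y > 0"
  shows "Digamma (y + real n) \<le> Digamma y + real n / y"
proof (induction n)
  case (Suc n)
  have "Digamma (y + real (Suc n)) = Digamma (y + real n) + 1 / (y + real n)"
    using Digamma_plus1[of "y + real n"] assms by (simp add: add_ac)
  moreover have "1 / (y + real n) \<le> 1 / y"
    using assms by (intro divide_left_mono) auto
  ultimately show ?case
    using Suc by (simp add: add_divide_distrib)
qed simp

text \<open>Gives decay as \<open>y\<close> grows with \<open>x\<close> fixed. By the mean value
  theorem the second difference is \<open>x * (Digamma t - Digamma s)\<close> with \<open>s\<close>
  and \<open>t\<close> between \<open>y\<close> and \<open>y + n\<close>, where
  \<open>Digamma\<close> grows by at most \<open>n / y\<close>.\<close>

lemma ln_Gamma_diff2_le: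
  assumes "x > 0" "y > 0" "2 * x \<le> real n"
  shows "ln_Gamma_diff2 x y \<le> x * real n / y"
proof -
  have der: "(ln_Gamma has_field_derivative Digamma t) (at t)" if "t > 0" for t :: real
    using that by (rule has_field_derivative_ln_Gamma_real)
  obtain s where s: "y < s" "s < x + y" "ln_Gamma (x + y) - ln_Gamma y = x * Digamma s"
    using MVT2[of y "x + y" ln_Gamma Digamma] der assms by auto
  obtain t where t: "x + y < t" "t < 2 * x + y"
    "ln_Gamma (2 * x + y) - ln_Gamma (x + y) = x * Digamma t"
    using MVT2[of "x + y" "2 * x + y" ln_Gamma Digamma] der assms by auto
  have "Digamma y \<le> Digamma s"
    using s assms by (intro Digamma_real_mono) auto
  moreover have "Digamma t \<le> Digamma (y + real n)"
    using t assms by (intro Digamma_real_mono) auto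
  ultimately have "Digamma t - Digamma s \<le> real n / y"
    using Digamma_add_of_nat_le[OF assms(2), of n] by linarith
  then have "x * (Digamma t - Digamma s) \<le> x * (real n / y)"
    using assms by (intro mult_left_mono) auto
  with s t show ?thesis
    by (simp add: ln_Gamma_diff2_def algebra_simps)
qed

section \<open>Existence and uniqueness of the solution that defines \<open>h\<close>\<close>

lemma ex1_h:
  fixes x :: real
  assumes "x > 0"
  shows "\<exists>!y. y > 0 \<and> 2 * Gamma (x + y) ^ 2 = Gamma y * Gamma (2 * x + y)"
proof -
  obtain n :: nat where n: "2 * x \<le> real n"
    using real_arch_simple by blast
  \<comment> \<open>The summand 1 makes \<open>x * n / b\<close> strictly smaller than
    \<open>ln 2\<close>, so the decay bound puts \<open>b\<close> below the level
    \<open>ln 2\<close>.\<close>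
  define b where "b = x * real n / ln 2 + 1"
  have b: "b > 0" using assms by (auto simp: b_def intro!: add_nonneg_pos)
  have "x * real n < b * ln 2"
    by (simp add: b_def field_simps)
  then have "x * real n / b < ln 2"
    using b by (simp add: field_simps)
  then have low: "ln_Gamma_diff2 x b < ln 2"
    using ln_Gamma_diff2_le[OF assms b n] by linarith
  have "eventually (\<lambda>y. ln 2 \<le> ln_Gamma_diff2 x y) (at_right 0)"
    using ln_Gamma_diff2_at_right_0[OF assms] by (simp add: filterlim_at_top)
  moreover have "eventually (\<lambda>y. y \<in> {0<..<b}) (at_right 0)"
    using b by (rule eventually_at_right_real)
  ultimately have "eventually (\<lambda>y. ln 2 \<le> ln_Gamma_diff2 x y \<and> y \<in> {0<..<b}) (at_right 0)"
    by (rule eventually_conj)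
  then obtain a where a: "ln 2 \<le> ln_Gamma_diff2 x a" "0 < a" "a < b"
    using eventually_happens'[OF trivial_limit_at_right_real] by force
  \<comment> \<open>The second difference is at least \<open>ln 2\<close> at \<open>a\<close> and
    below it at \<open>b\<close>, so the intermediate value theorem applies.\<close>
  have "\<exists>y. a \<le> y \<and> y \<le> b \<and> ln_Gamma_diff2 x y = ln 2"
    using a low assms
    by (intro IVT2 allI impI DERIV_isCont[OF has_field_derivative_ln_Gamma_diff2]) auto
  then obtain y where y: "y > 0" "ln_Gamma_diff2 x y = ln 2"
    using a(2) by (meson less_le_trans)
  show ?thesis
  proof (rule ex1I[of _ y])
    show "y > 0 \<and> 2 * Gamma (x + y) ^ 2 = Gamma y * Gamma (2 * x + y)"
      using y ln_Gamma_diff2_eq_ln2_iff assms by blast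
  next
    fix z assume z: "z > 0 \<and> 2 * Gamma (x + z) ^ 2 = Gamma z * Gamma (2 * x + z)"
    then have "ln_Gamma_diff2 x z = ln 2"
      using ln_Gamma_diff2_eq_ln2_iff assms by blast
    with y z assms ln_Gamma_diff2_strict_antimono[of x y z]
      ln_Gamma_diff2_strict_antimono[of x z y]
    show "z = y" by (cases y z rule: linorder_cases) auto
  qed
qed

lemma h_pos: "x > 0 \<Longrightarrow> h x > 0"
  and ln_Gamma_diff2_h: "x > 0 \<Longrightarrow> ln_Gamma_diff2 x (h x) = ln 2"
  using theI'[OF ex1_h, of x] ln_Gamma_diff2_eq_ln2_iff[of x "h x"] by (auto simp: h_def)

lemma Gamma_prod_less_of_gt_h:
  assumes "x > 0" "y > h x"
  shows "Gamma y * Gamma (2 * x + y) < 2 * Gamma (x + y) ^ 2"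
proof -
  have "ln_Gamma_diff2 x y < ln 2"
    using ln_Gamma_diff2_strict_antimono[OF assms(1) h_pos[OF assms(1)] assms(2)]
      ln_Gamma_diff2_h[OF assms(1)] by simp
  moreover have "y > 0" using h_pos[OF assms(1)] assms(2) by simp
  ultimately show ?thesis using ln_Gamma_diff2_less_ln2_iff assms(1) by blast
qed

section \<open>Power series with bounded coefficients on the imaginary axis\<close>

lemma Bseq_inverse_Gamma_linear:
  fixes \<alpha> \<beta> :: real
  assumes "\<alpha> > 0"
  shows "Bseq (\<lambda>k. 1 / Gamma (\<alpha> * real k + \<beta>))"
proof -
  have "filterlim (\<lambda>k. \<beta> + \<alpha> * real k) at_top sequentially"
    using assms
    by (intro filterlim_tendsto_add_at_top[OF tendsto_const]
        filterlim_tendsto_pos_mult_at_top[OF tendsto_const] filterlim_real_sequentially)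
  then have "eventually (\<lambda>k. 2 \<le> \<beta> + \<alpha> * real k) sequentially"
    by (simp add: filterlim_at_top)
  then have "eventually (\<lambda>k. norm (1 / Gamma (\<alpha> * real k + \<beta>)) \<le> norm (1 :: real)) sequentially"
  proof eventually_elim
    case (elim k)
    \<comment> \<open>\<open>Gamma\<close> is increasing from 2 on, so its value at 2 bounds it
      below by 1 there.\<close>
    have "Gamma (2 :: real) = 1" using Gamma_fact[of 1, where 'a = real] by simp
    then have "1 \<le> Gamma (\<alpha> * real k + \<beta>)"
      using Gamma_real_strict_mono[of 2 "\<alpha> * real k + \<beta>"] elim
      by (cases "\<alpha> * real k + \<beta> = 2") auto
    then show ?case by simp
  qed
  then show ?thesis
    by (rule Bseq_eventually_mono) simp
qed

text \<open>The first three terms lower the squared norm by about \<open>D * y ^ 2\<close>, while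
  comparison with a geometric series bounds the remaining terms by a multiple of
  \<open>y ^ 3\<close>.\<close>

lemma ex_norm_powser_imaginary_less:
  fixes a :: "nat \<Rightarrow> real"
  assumes bdd: "Bseq a" and a0: "a 0 > 0" and a1: "a 1 ^ 2 < 2 * a 0 * a 2"
  shows "\<exists>y. norm (\<Sum>k. of_real (a k) * (\<i> * of_real y) ^ k :: complex) < a 0"
proof -
  obtain M where M: "M > 0" "\<And>k. \<bar>a k\<bar> \<le> M"
    using bdd by (auto elim!: BseqE)
  define D where "D = 2 * a 0 * a 2 - a 1 ^ 2"
  have D: "D > 0" using a1 by (simp add: D_def)
  \<comment> \<open>Keeps \<open>a 0 - 2 * M * y ^ 3\<close> positive, so that norms can be compared
    through their squares.\<close>
  have ev1: "eventually (\<lambda>y. 2 * M * y ^ 3 < a 0) (at_right (0::real))"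
    using a0 by (intro order_tendstoD(2)[of _ 0]) (auto intro!: tendsto_eq_intros)
  \<comment> \<open>Lets the quadratic gain absorb the quartic term of the squared norm and the
    cross term \<open>4 * M * a 0 * y ^ 3\<close> produced by the tail.\<close>
  have ev2: "eventually (\<lambda>y. a 2 ^ 2 * y ^ 2 + 4 * M * a 0 * y < D) (at_right (0::real))"
    using D by (intro order_tendstoD(2)[of _ 0]) (auto intro!: tendsto_eq_intros)
  \<comment> \<open>Below 1/2 the geometric factor \<open>1 / (1 - y)\<close> is at most 2.\<close>
  have "eventually (\<lambda>y. y \<in> {0<..<1/2}) (at_right (0::real))"
    by (rule eventually_at_right_real) simp
  with ev1 ev2 have "eventually (\<lambda>y. 2 * M * y ^ 3 < a 0 \<and>
      a 2 ^ 2 * y ^ 2 + 4 * M * a 0 * y < D \<and> y \<in> {0<..<1/2}) (at_right (0::real))"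
    by (intro eventually_conj)
  then obtain y where y: "2 * M * y ^ 3 < a 0" "a 2 ^ 2 * y ^ 2 + 4 * M * a 0 * y < D"
      "0 < y" "y < 1/2"
    using eventually_happens'[OF trivial_limit_at_right_real] by force
  define f :: "nat \<Rightarrow> complex" where "f k = of_real (a k) * (\<i> * of_real y) ^ k" for k
  have bound: "norm (f k) \<le> M * y ^ k" for k
    using M(2)[of k] y(3) by (auto simp: f_def norm_mult norm_power intro!: mult_right_mono)
  have geo: "(\<lambda>k. M * y ^ (k + 3)) sums (M * y ^ 3 / (1 - y))"
    using sums_mult[OF geometric_sums[of y], of "M * y ^ 3"] y(3,4)
    by (simp add: power_add mult_ac)
  have "summable f"
    by (rule summable_comparison_test'[of "\<lambda>k. M * y ^ k" 0])
       (use bound y(3,4) in \<open>auto intro!: summable_mult summable_geometric\<close>)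
  then have split: "suminf f = (\<Sum>k. f (k + 3)) + (\<Sum>k<3. f k)"
    by (rule suminf_split_initial_segment)
  have "norm (\<Sum>k. f (k + 3)) \<le> M * y ^ 3 / (1 - y)"
    using norm_suminf_le[of "\<lambda>k. f (k + 3)" "\<lambda>k. M * y ^ (k + 3)", OF bound sums_summable[OF geo]]
      sums_unique[OF geo] by simp
  also have "\<dots> \<le> 2 * M * y ^ 3"
  proof -
    have "M * y ^ 3 * 1 \<le> M * y ^ 3 * (2 * (1 - y))"
      using M y by (intro mult_left_mono) auto
    then show ?thesis using y(3,4) by (simp add: field_simps)
  qed
  finally have tail: "norm (\<Sum>k. f (k + 3)) \<le> 2 * M * y ^ 3" .
  have "(\<Sum>k<3. f k) = Complex (a 0 - a 2 * y ^ 2) (a 1 * y)"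
    by (simp add: f_def eval_nat_numeral complex_eq_iff)
  then have "norm (\<Sum>k<3. f k) ^ 2 = (a 0 - a 2 * y ^ 2) ^ 2 + (a 1 * y) ^ 2"
    by (simp add: cmod_power2)
  also have "\<dots> = a 0 ^ 2 - y ^ 2 * (D - a 2 ^ 2 * y ^ 2)"
    by (simp add: D_def algebra_simps power2_eq_square)
  also have "\<dots> < a 0 ^ 2 - y ^ 2 * (4 * M * a 0 * y)"
    using y(2,3) by (intro diff_strict_left_mono mult_strict_left_mono) auto
  \<comment> \<open>The two sides differ by the square \<open>4 * M ^ 2 * y ^ 6\<close>.\<close>
  also have "\<dots> \<le> (a 0 - 2 * M * y ^ 3) ^ 2"
    using M(1) y(3) by (simp add: power2_diff power2_eq_square power3_eq_cube algebra_simps)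
  finally have "norm (\<Sum>k<3. f k) < a 0 - 2 * M * y ^ 3"
    by (rule power2_less_imp_less) (use y(1) in simp)
  with tail norm_triangle_ineq[of "\<Sum>k. f (k + 3)" "\<Sum>k<3. f k"]
  have "norm (suminf f) < a 0" unfolding split by linarith
  then show ?thesis unfolding f_def by blast
qed

theorem proposition17:
  fixes \<alpha> \<beta> :: real
  assumes "\<alpha> > 0" and "\<beta> > h \<alpha>"
  shows "\<exists>z::complex. norm (mittag_leffler \<alpha> \<beta> z) < mittag_leffler \<alpha> \<beta> (Re z)"
proof -
  define a where "a k = 1 / Gamma (\<alpha> * real k + \<beta>)" for k
  have \<beta>: "\<beta> > 0" using h_pos[OF assms(1)] assms(2) by simp
  have pos: "Gamma \<beta> > 0" "Gamma (\<alpha> + \<beta>) > 0" "Gamma (2 * \<alpha> + \<beta>) > 0"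
    using assms(1) \<beta> by (auto intro!: Gamma_real_pos)
  have "a 0 > 0" using pos by (simp add: a_def)
  \<comment> \<open>Clearing the positive denominators turns this into the \<open>Gamma\<close>
    inequality valid beyond \<open>h \<alpha>\<close>.\<close>
  moreover have "a 1 ^ 2 < 2 * a 0 * a 2"
    using Gamma_prod_less_of_gt_h[OF assms] pos
    by (simp add: a_def power_divide divide_simps mult_ac)
  ultimately obtain y where
    y: "norm (\<Sum>k. of_real (a k) * (\<i> * of_real y) ^ k :: complex) < a 0"
    using ex_norm_powser_imaginary_less Bseq_inverse_Gamma_linear[OF assms(1)]
    unfolding a_def by blast
  have "mittag_leffler \<alpha> \<beta> (\<i> * of_real y) = (\<Sum>k. of_real (a k) * (\<i> * of_real y) ^ k :: complex)"
    by (simp add: mittag_leffler_def a_def)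
  \<comment> \<open>The witness has real part 0, where only the constant term survives because
    \<open>0 ^ 0 = 1\<close>.\<close>
  moreover have "mittag_leffler \<alpha> \<beta> (0 :: real) = a 0"
    using powser_zero[of a] by (simp add: mittag_leffler_def a_def)
  ultimately have "norm (mittag_leffler \<alpha> \<beta> (\<i> * of_real y :: complex))
      < mittag_leffler \<alpha> \<beta> (Re (\<i> * of_real y))"
    using y by simp
  then show ?thesis ..
qed

end
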